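(* Consider the two-dimensional CU scheme described in the context. If $$\mathbf u^\pm_{j+\frac12,k}\in\mathcal G,\quad\mathbf u^\pm_{j,k+\frac12}\in\mathcal G,\quad\mathbf u^{*,\pm}_{j+\frac12,k}\in\mathcal G,\quad\mathbf u^{*,\pm}_{j,k+\frac12}\in\mathcal G,\quad\mathbf u^{*,x}_{j,k}\in\mathcal G,\quad\mathbf u^{*,y}_{j,k}\in\mathcal G$$ for all $j,k$, then, under the CFL condition $$\lambda^n\alpha_1+\mu^n\alpha_2\le\tfrac12,\quad\alpha_1:=\max_{j,k}\big\{\sigma^+_{j+\frac12,k}-\sigma^-_{j+\frac12,k}\big\},\quad\alpha_2:=\max_{j,k}\big\{\sigma^+_{j,k+\frac12}-\sigma^-_{j,k+\frac12}\big\},$$ one has $\overline{\mathbf u}_{j,k}^{\,n+1}\in\mathcal G$ for all $j,k$, that is, the scheme is bound-preserving.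
   Context: Consider a 2-D hyperbolic system $\mathbf u_t+\mathbf f(\mathbf u)_x+\mathbf g(\mathbf u)_y=\mathbf 0$, $\mathbf u\in\mathbb R^m$, with a convex invariant region $$\mathcal G=\{\mathbf u\in\mathbb R^m:\varphi_i(\mathbf u)>0,\ i\in\mathbb I,\ \text{and}\ \varphi_i(\mathbf u)\ge0,\ i\in\hat{\mathbb I}\}$$ ($\varphi_i$ continuous, $\mathcal G$ convex, $\mathbf f,\mathbf g$ defined on $\mathcal G$). With $\Delta x,\Delta y,\Delta t^n>0$, $\lambda^n:=\Delta t^n/\Delta x$, $\mu^n:=\Delta t^n/\Delta y$ and cell averages $\overline{\mathbf u}_{j,k}^{\,n}$, $j,k\in\mathbb Z$, the 2-D CU scheme is $$\overline{\mathbf u}^{\,n+1}_{j,k}=\overline{\mathbf u}^{\,n}_{j,k}-\lambda^n\big(\hat{\mathbf f}_{j+\frac12,k}-\hat{\mathbf f}_{j-\frac12,k}\big)-\mu^n\big(\hat{\mathbf g}_{j,k+\frac12}-\hat{\mathbf g}_{j,k-\frac12}\big),$$ $$\hat{\mathbf f}_{j+\frac12,k}=\tfrac{\sigma^+_{j+\frac12,k}\mathbf f(\mathbf u^-_{j+\frac12,k})-\sigma^-_{j+\frac12,k}\mathbf f(\mathbf u^+_{j+\frac12,k})}{\sigma^+_{j+\frac12,k}-\sigma^-_{j+\frac12,k}}+\tfrac{\sigma^+_{j+\frac12,k}\sigma^-_{j+\frac12,k}}{\sigma^+_{j+\frac12,k}-\sigma^-_{j+\frac12,k}}\big(\mathbf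 u^+_{j+\frac12,k}-\mathbf u^-_{j+\frac12,k}-\mathbf d_{j+\frac12,k}\big),$$ $$\hat{\mathbf g}_{j,k+\frac12}=\tfrac{\sigma^+_{j,k+\frac12}\mathbf g(\mathbf u^-_{j,k+\frac12})-\sigma^-_{j,k+\frac12}\mathbf g(\mathbf u^+_{j,k+\frac12})}{\sigma^+_{j,k+\frac12}-\sigma^-_{j,k+\frac12}}+\tfrac{\sigma^+_{j,k+\frac12}\sigma^-_{j,k+\frac12}}{\sigma^+_{j,k+\frac12}-\sigma^-_{j,k+\frac12}}\big(\mathbf u^+_{j,k+\frac12}-\mathbf u^-_{j,k+\frac12}-\mathbf d_{j,k+\frac12}\big).$$ Here $\mathbf u^-_{j+\frac12,k}=\overline{\mathbf u}_{j,k}^{\,n}+\frac{\Delta x}2(\mathbf u_x)_{j,k}^n$, $\mathbf u^+_{j+\frac12,k}=\overline{\mathbf u}_{j+1,k}^{\,n}-\frac{\Delta x}2(\mathbf u_x)_{j+1,k}^n$, $\mathbf u^-_{j,k+\frac12}=\overline{\mathbf u}_{j,k}^{\,n}+\frac{\Delta y}2(\mathbf u_y)_{j,k}^n$, $\mathbf u^+_{j,k+\frac12}=\overline{\mathbf u}_{j,k+1}^{\,n}-\frac{\Delta y}2(\mathbf u_y)_{j,k+1}^n$ for some slopes $(\mathbf u_x)_{j,k}^n,(\mathbf u_y)_{j,k}^n\in\mathbb R^m$; the one-sided local speeds satisfy $\sigma^-\le0\le\sigma^+$ and $\sigma^+>\sigma^-$ at every interface, and $\sigma^+_{j+\frac12,k}>\sigma^-_{j-\frac12,k}$,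 $\sigma^+_{j,k+\frac12}>\sigma^-_{j,k-\frac12}$ for all $j,k$; $\mathbf d_{j+\frac12,k},\mathbf d_{j,k+\frac12}\in\mathbb R^m$ are the anti-diffusion terms. For $\mathbf h=\mathbf f$ or $\mathbf g$ (giving $R_h=R_f$ or $R_g$) set $$R_h(\sigma^+,\sigma^-,\mathbf u^+,\mathbf u^-):=\frac{\sigma^+\mathbf u^+-\sigma^-\mathbf u^--\mathbf h(\mathbf u^+)+\mathbf h(\mathbf u^-)}{\sigma^+-\sigma^-},$$ and define $\mathbf u^*_{j+\frac12,k}=R_f(\sigma^+_{j+\frac12,k},\sigma^-_{j+\frac12,k},\mathbf u^+_{j+\frac12,k},\mathbf u^-_{j+\frac12,k})$, $\mathbf u^*_{j,k+\frac12}=R_g(\sigma^+_{j,k+\frac12},\sigma^-_{j,k+\frac12},\mathbf u^+_{j,k+\frac12},\mathbf u^-_{j,k+\frac12})$, and $$\mathbf u^{*,\pm}_{j+\frac12,k}:=\mathbf u^*_{j+\frac12,k}-\tfrac{\sigma^\pm_{j+\frac12,k}}{\sigma^+_{j+\frac12,k}-\sigma^-_{j+\frac12,k}}\mathbf d_{j+\frac12,k},\quad \mathbf u^{*,x}_{j,k}:=R_f\big(\sigma^+_{j+\frac12,k},\sigma^-_{j-\frac12,k},\mathbf u^-_{j+\frac12,k},\mathbf u^+_{j-\frac12,k}\big),$$ $$\mathbf u^{*,\pm}_{j,k+\frac12}:=\mathbf u^*_{j,k+\frac12}-\tfrac{\sigma^\pm_{j,k+\frac12}}{\sigma^+_{j,k+\frac12}-\sigma^-_{j,k+\frac12}}\mathbf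 d_{j,k+\frac12},\quad \mathbf u^{*,y}_{j,k}:=R_g\big(\sigma^+_{j,k+\frac12},\sigma^-_{j,k-\frac12},\mathbf u^-_{j,k+\frac12},\mathbf u^+_{j,k-\frac12}\big).$$ *)

theory Defs
  imports "HOL-Analysis.Analysis"
begin

definition region :: "'i set \<Rightarrow> 'i set \<Rightarrow> ('i \<Rightarrow> real ^ 'm \<Rightarrow> real) \<Rightarrow> (real ^ 'm) set" where
  "region I I' \<phi> = {u. (\<forall>i\<in>I. \<phi> i u > 0) \<and> (\<forall>i\<in>I'. \<phi> i u \<ge> 0)}"

text \<open>
  All data entering one step of the scheme, from time level n to n + 1. Half-integer indices are
  shifted down: a field attached to x-interfaces, at (j, k), is the quantity at (j + 1/2, k), so
  the one at (j - 1/2, k) is found at (j - 1, k); a field attached to y-interfaces, at (j, k), is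
  the quantity at (j, k + 1/2). The fluxes are total functions, but only their values on the
  invariant region are meaningful.
\<close>

record ('m::finite) cu_scheme =
  flux_f :: "real ^ 'm \<Rightarrow> real ^ 'm"
  flux_g :: "real ^ 'm \<Rightarrow> real ^ 'm"
  \<Delta>x :: real
  \<Delta>y :: real
  \<Delta>t :: real
  avg :: "int \<Rightarrow> int \<Rightarrow> real ^ 'm"
  slope_x :: "int \<Rightarrow> int \<Rightarrow> real ^ 'm"
  slope_y :: "int \<Rightarrow> int \<Rightarrow> real ^ 'm"
  \<sigma>x_plus :: "int \<Rightarrow> int \<Rightarrow> real"
  \<sigma>x_minus :: "int \<Rightarrow> int \<Rightarrow> real"
  \<sigma>y_plus :: "int \<Rightarrow> int \<Rightarrow> real"
  \<sigma>y_minus :: "int \<Rightarrow> int \<Rightarrow> real"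
  antidiff_x :: "int \<Rightarrow> int \<Rightarrow> real ^ 'm"
  antidiff_y :: "int \<Rightarrow> int \<Rightarrow> real ^ 'm"

definition mesh_lambda :: "'m::finite cu_scheme \<Rightarrow> real" where
  "mesh_lambda S = \<Delta>t S / \<Delta>x S"

definition mesh_mu :: "'m::finite cu_scheme \<Rightarrow> real" where
  "mesh_mu S = \<Delta>t S / \<Delta>y S"

definition ux_minus :: "'m::finite cu_scheme \<Rightarrow> int \<Rightarrow> int \<Rightarrow> real ^ 'm" where
  "ux_minus S j k = avg S j k + (\<Delta>x S / 2) *\<^sub>R slope_x S j k"

definition ux_plus :: "'m::finite cu_scheme \<Rightarrow> int \<Rightarrow> int \<Rightarrow> real ^ 'm" where
  "ux_plus S j k = avg S (j + 1) k - (\<Delta>x S / 2) *\<^sub>R slope_x S (j + 1) k"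

definition uy_minus :: "'m::finite cu_scheme \<Rightarrow> int \<Rightarrow> int \<Rightarrow> real ^ 'm" where
  "uy_minus S j k = avg S j k + (\<Delta>y S / 2) *\<^sub>R slope_y S j k"

definition uy_plus :: "'m::finite cu_scheme \<Rightarrow> int \<Rightarrow> int \<Rightarrow> real ^ 'm" where
  "uy_plus S j k = avg S j (k + 1) - (\<Delta>y S / 2) *\<^sub>R slope_y S j (k + 1)"

definition cu_flux ::
  "(real ^ 'm \<Rightarrow> real ^ 'm) \<Rightarrow> real \<Rightarrow> real \<Rightarrow> real ^ 'm \<Rightarrow> real ^ 'm \<Rightarrow> real ^ 'm \<Rightarrow> real ^ 'm" where
  "cu_flux h sp sm up um d =
     (sp *\<^sub>R h um - sm *\<^sub>R h up) /\<^sub>R (sp - sm) + (sp * sm / (sp - sm)) *\<^sub>R (up - um - d)"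

definition num_flux_x :: "'m::finite cu_scheme \<Rightarrow> int \<Rightarrow> int \<Rightarrow> real ^ 'm" where
  "num_flux_x S j k = cu_flux (flux_f S) (\<sigma>x_plus S j k) (\<sigma>x_minus S j k)
     (ux_plus S j k) (ux_minus S j k) (antidiff_x S j k)"

definition num_flux_y :: "'m::finite cu_scheme \<Rightarrow> int \<Rightarrow> int \<Rightarrow> real ^ 'm" where
  "num_flux_y S j k = cu_flux (flux_g S) (\<sigma>y_plus S j k) (\<sigma>y_minus S j k)
     (uy_plus S j k) (uy_minus S j k) (antidiff_y S j k)"

definition next_avg :: "'m::finite cu_scheme \<Rightarrow> int \<Rightarrow> int \<Rightarrow> real ^ 'm" where
  "next_avg S j k = avg S j k
     - mesh_lambda S *\<^sub>R (num_flux_x S j k - num_flux_x S (j - 1) k)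
     - mesh_mu S *\<^sub>R (num_flux_y S j k - num_flux_y S j (k - 1))"

definition R_state ::
  "(real ^ 'm \<Rightarrow> real ^ 'm) \<Rightarrow> real \<Rightarrow> real \<Rightarrow> real ^ 'm \<Rightarrow> real ^ 'm \<Rightarrow> real ^ 'm" where
  "R_state h sp sm up um = (sp *\<^sub>R up - sm *\<^sub>R um - h up + h um) /\<^sub>R (sp - sm)"

definition ustar_x :: "'m::finite cu_scheme \<Rightarrow> int \<Rightarrow> int \<Rightarrow> real ^ 'm" where
  "ustar_x S j k = R_state (flux_f S) (\<sigma>x_plus S j k) (\<sigma>x_minus S j k)
     (ux_plus S j k) (ux_minus S j k)"

definition ustar_y :: "'m::finite cu_scheme \<Rightarrow> int \<Rightarrow> int \<Rightarrow> real ^ 'm" where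
  "ustar_y S j k = R_state (flux_g S) (\<sigma>y_plus S j k) (\<sigma>y_minus S j k)
     (uy_plus S j k) (uy_minus S j k)"

definition ustar_x_plus :: "'m::finite cu_scheme \<Rightarrow> int \<Rightarrow> int \<Rightarrow> real ^ 'm" where
  "ustar_x_plus S j k = ustar_x S j k
     - (\<sigma>x_plus S j k / (\<sigma>x_plus S j k - \<sigma>x_minus S j k)) *\<^sub>R antidiff_x S j k"

definition ustar_x_minus :: "'m::finite cu_scheme \<Rightarrow> int \<Rightarrow> int \<Rightarrow> real ^ 'm" where
  "ustar_x_minus S j k = ustar_x S j k
     - (\<sigma>x_minus S j k / (\<sigma>x_plus S j k - \<sigma>x_minus S j k)) *\<^sub>R antidiff_x S j k"

definition ustar_y_plus :: "'m::finite cu_scheme \<Rightarrow> int \<Rightarrow> int \<Rightarrow> real ^ 'm" where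
  "ustar_y_plus S j k = ustar_y S j k
     - (\<sigma>y_plus S j k / (\<sigma>y_plus S j k - \<sigma>y_minus S j k)) *\<^sub>R antidiff_y S j k"

definition ustar_y_minus :: "'m::finite cu_scheme \<Rightarrow> int \<Rightarrow> int \<Rightarrow> real ^ 'm" where
  "ustar_y_minus S j k = ustar_y S j k
     - (\<sigma>y_minus S j k / (\<sigma>y_plus S j k - \<sigma>y_minus S j k)) *\<^sub>R antidiff_y S j k"

text \<open>
  Unlike \<open>ustar_x\<close> and \<open>ustar_y\<close>, the next two states live at cell (j, k) and combine the two
  interfaces of that cell: the left interface trace is the "minus" argument.
\<close>

definition ustar_cell_x :: "'m::finite cu_scheme \<Rightarrow> int \<Rightarrow> int \<Rightarrow> real ^ 'm" where
  "ustar_cell_x S j k = R_state (flux_f S) (\<sigma>x_plus S j k) (\<sigma>x_minus S (j - 1) k)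
     (ux_minus S j k) (ux_plus S (j - 1) k)"

definition ustar_cell_y :: "'m::finite cu_scheme \<Rightarrow> int \<Rightarrow> int \<Rightarrow> real ^ 'm" where
  "ustar_cell_y S j k = R_state (flux_g S) (\<sigma>y_plus S j k) (\<sigma>y_minus S j (k - 1))
     (uy_minus S j k) (uy_plus S j (k - 1))"

text \<open>
  The maxima over the infinite grid are taken as suprema in the extended reals, which agree with
  the maxima whenever these exist. An infinite supremum makes the CFL condition false.
\<close>

definition \<alpha>\<^sub>1 :: "'m::finite cu_scheme \<Rightarrow> ereal" where
  "\<alpha>\<^sub>1 S = (SUP (j, k)\<in>UNIV. ereal (\<sigma>x_plus S j k - \<sigma>x_minus S j k))"

definition \<alpha>\<^sub>2 :: "'m::finite cu_scheme \<Rightarrow> ereal" where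
  "\<alpha>\<^sub>2 S = (SUP (j, k)\<in>UNIV. ereal (\<sigma>y_plus S j k - \<sigma>y_minus S j k))"

end

theory Submission imports Defs begin

text \<open>
  A numerical flux is the physical flux at either adjacent trace plus the jump across the
  corresponding wave, so a one-dimensional update is a convex combination of the two traces, the
  cell state, and the two neighbouring corrected star states as long as each wave fan is at most
  half a cell wide. The two-dimensional update is a convex combination of two such
  one-dimensional updates, weighted in proportion to their Courant numbers.
\<close>

text \<open>The coefficient \<open>sp * sm / (sp - sm)\<close> of \<open>d\<close> factors as the
  left speed \<open>sm\<close> times \<open>sp / (sp - sm)\<close>. Hence the left wave leads to the
  star state corrected with the opposite speed.\<close>

lemma cu_flux_eq_left_trace:
  assumes "sm < sp"
  shows "cu_flux h sp sm up um d =
    h um + sm *\<^sub>R (R_state h sp sm up um - (sp / (sp - sm)) *\<^sub>R d - um)"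
proof -
  \<comment> \<open>Naming the gap \<open>e\<close> collapses the denominator \<open>sp - sm\<close>
    to one nonzero variable, so clearing fractions settles the identity.\<close>
  obtain e where "sp = sm + e" "e \<noteq> 0"
    using assms by (intro that[of "sp - sm"]) auto
  then show ?thesis
    unfolding cu_flux_def R_state_def vec_eq_iff by (simp add: field_simps)
qed

lemma cu_flux_eq_right_trace:
  assumes "sm < sp"
  shows "cu_flux h sp sm up um d =
    h up + sp *\<^sub>R (R_state h sp sm up um - (sm / (sp - sm)) *\<^sub>R d - up)"
proof -
  obtain e where "sp = sm + e" "e \<noteq> 0"
    using assms by (intro that[of "sp - sm"]) auto
  then show ?thesis
    unfolding cu_flux_def R_state_def vec_eq_iff by (simp add: field_simps)
qed

lemma R_state_flux_difference:
  assumes "sm < sp"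
  shows "h up - h um = sp *\<^sub>R up - sm *\<^sub>R um - (sp - sm) *\<^sub>R R_state h sp sm up um"
  using assms unfolding R_state_def by simp

text \<open>Suffixes \<open>R\<close> and \<open>L\<close> mark the right and left interface of one
  cell, so \<open>umR\<close> and \<open>upL\<close> are its inner traces. The ratio
  \<open>l\<close> is free because the lemma is applied with enlarged time steps.\<close>

lemma cu_update_1d_in_convex:
  fixes G :: "(real ^ 'm) set"
  assumes G: "convex G"
    and l: "0 \<le> l"
    and L: "smL \<le> 0" "0 \<le> spL" "smL < spL" "l * (spL - smL) \<le> 1 / 2"
    and R: "smR \<le> 0" "0 \<le> spR" "smR < spR" "l * (spR - smR) \<le> 1 / 2"
    and cell: "smL < spR"
    and v: "v = (1 / 2) *\<^sub>R (umR + upL)"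
    and traces: "umR \<in> G" "upL \<in> G"
    and starR: "R_state h spR smR upR umR - (spR / (spR - smR)) *\<^sub>R dR \<in> G"
    and starL: "R_state h spL smL upL umL - (smL / (spL - smL)) *\<^sub>R dL \<in> G"
    and star: "R_state h spR smL umR upL \<in> G"
  shows "v - l *\<^sub>R (cu_flux h spR smR upR umR dR - cu_flux h spL smL upL umL dL) \<in> G"
proof -
  \<comment> \<open>The last three weights are \<open>l\<close> times the speeds bounding each star
    state. A trace starts with 1/2 from \<open>v\<close> and loses \<open>l\<close> times the fan
    width at its own interface: one speed comes from the interface flux, the other from the flux
    difference across the cell.\<close>
  define w where "w = (\<lambda>i::nat. [1 / 2 - l * (spR - smR), 1 / 2 - l * (spL - smL),
    l * (spR - smL), - (l * smR), l * spL] ! i)"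
  define x where "x = (\<lambda>i::nat. [umR, upL, R_state h spR smL umR upL,
    R_state h spR smR upR umR - (spR / (spR - smR)) *\<^sub>R dR,
    R_state h spL smL upL umL - (smL / (spL - smL)) *\<^sub>R dL] ! i)"
  have "(\<Sum>i<5. w i *\<^sub>R x i) \<in> G"
  proof (rule convex_sum[OF _ G])
    show "(\<Sum>i<5. w i) = 1"
      by (simp add: w_def eval_nat_numeral algebra_simps)
    fix i :: nat
    assume "i \<in> {..<5}"
    then consider "i = 0" | "i = 1" | "i = 2" | "i = 3" | "i = 4"
      by fastforce
    note cases = this
    from cases show "0 \<le> w i"
      by cases (use l L R cell in \<open>auto simp: w_def mult_nonneg_nonpos\<close>)
    from cases show "x i \<in> G"
      by cases (use traces starR starL star in \<open>auto simp: x_def\<close>)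
  qed simp
  moreover have "(\<Sum>i<5. w i *\<^sub>R x i) =
    v - l *\<^sub>R (cu_flux h spR smR upR umR dR - cu_flux h spL smL upL umL dL)"
  proof -
    define sR where "sR = R_state h spR smR upR umR - (spR / (spR - smR)) *\<^sub>R dR"
    define sL where "sL = R_state h spL smL upL umL - (smL / (spL - smL)) *\<^sub>R dL"
    define s where "s = R_state h spR smL umR upL"
    \<comment> \<open>The cell state absorbs the difference of the fluxes at the inner traces;
      \<open>h upL\<close> then cancels, leaving an identity linear in the five states.\<close>
    have h: "h umR = h upL + (spR *\<^sub>R umR - smL *\<^sub>R upL - (spR - smL) *\<^sub>R s)"
      using R_state_flux_difference[OF cell, of h umR upL] unfolding s_def
      by (simp add: algebra_simps)
    have "(\<Sum>i<5. w i *\<^sub>R x i) = (1 / 2 - l * (spR - smR)) *\<^sub>R umR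
      + (1 / 2 - l * (spL - smL)) *\<^sub>R upL + (l * (spR - smL)) *\<^sub>R s
      + (- (l * smR)) *\<^sub>R sR + (l * spL) *\<^sub>R sL"
      by (simp add: w_def x_def sR_def sL_def s_def eval_nat_numeral)
    also have "\<dots> = v - l *\<^sub>R (h umR + smR *\<^sub>R (sR - umR) - (h upL + spL *\<^sub>R (sL - upL)))"
      unfolding h v vec_eq_iff by (simp add: algebra_simps)
    finally show ?thesis
      unfolding cu_flux_eq_left_trace[OF R(3)] cu_flux_eq_right_trace[OF L(3)] sR_def sL_def .
  qed
  ultimately show ?thesis
    by simp
qed

text \<open>The two index pairs are independent because the widest x-fan and y-fan of a cell may sit
  at unrelated interfaces. Nonnegative mesh ratios let the supremum bounds be multiplied in
  \<open>ereal\<close>.\<close>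

lemma cfl_pointwise:
  assumes "0 \<le> mesh_lambda S" "0 \<le> mesh_mu S"
    and "ereal (mesh_lambda S) * \<alpha>\<^sub>1 S + ereal (mesh_mu S) * \<alpha>\<^sub>2 S \<le> ereal c"
  shows "mesh_lambda S * (\<sigma>x_plus S j k - \<sigma>x_minus S j k)
    + mesh_mu S * (\<sigma>y_plus S j' k' - \<sigma>y_minus S j' k') \<le> c"
proof -
  have "ereal (\<sigma>x_plus S j k - \<sigma>x_minus S j k) \<le> \<alpha>\<^sub>1 S"
    unfolding \<alpha>\<^sub>1_def by (rule SUP_upper2[of "(j, k)"]) auto
  moreover have "ereal (\<sigma>y_plus S j' k' - \<sigma>y_minus S j' k') \<le> \<alpha>\<^sub>2 S"
    unfolding \<alpha>\<^sub>2_def by (rule SUP_upper2[of "(j', k')"]) auto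
  ultimately have "ereal (mesh_lambda S) * ereal (\<sigma>x_plus S j k - \<sigma>x_minus S j k)
    + ereal (mesh_mu S) * ereal (\<sigma>y_plus S j' k' - \<sigma>y_minus S j' k') \<le> ereal c"
    using assms by (meson add_mono ereal_mult_left_mono ereal_less_eq(5) order_trans)
  then show ?thesis
    by simp
qed

theorem corollary3p1:
  fixes I I' :: "'i set" and \<phi> :: "'i \<Rightarrow> real ^ 'm \<Rightarrow> real"
    and G :: "(real ^ 'm) set" and S :: "'m::finite cu_scheme"
  assumes "\<And>i. i \<in> I \<union> I' \<Longrightarrow> continuous_on UNIV (\<phi> i)"
    and "G = region I I' \<phi>"
    and "convex G"
    and "\<Delta>x S > 0" "\<Delta>y S > 0" "\<Delta>t S > 0"
    and "\<And>j k. \<sigma>x_minus S j k \<le> 0 \<and> 0 \<le> \<sigma>x_plus S j k \<and> \<sigma>x_minus S j k < \<sigma>x_plus S j k"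
    and "\<And>j k. \<sigma>y_minus S j k \<le> 0 \<and> 0 \<le> \<sigma>y_plus S j k \<and> \<sigma>y_minus S j k < \<sigma>y_plus S j k"
    and "\<And>j k. \<sigma>x_minus S (j - 1) k < \<sigma>x_plus S j k"
    and "\<And>j k. \<sigma>y_minus S j (k - 1) < \<sigma>y_plus S j k"
    and "\<And>j k. ux_minus S j k \<in> G" "\<And>j k. ux_plus S j k \<in> G"
    and "\<And>j k. uy_minus S j k \<in> G" "\<And>j k. uy_plus S j k \<in> G"
    and "\<And>j k. ustar_x_minus S j k \<in> G" "\<And>j k. ustar_x_plus S j k \<in> G"
    and "\<And>j k. ustar_y_minus S j k \<in> G" "\<And>j k. ustar_y_plus S j k \<in> G"
    and "\<And>j k. ustar_cell_x S j k \<in> G" "\<And>j k. ustar_cell_y S j k \<in> G"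
    and "ereal (mesh_lambda S) * \<alpha>\<^sub>1 S + ereal (mesh_mu S) * \<alpha>\<^sub>2 S \<le> ereal (1 / 2)"
  shows "\<forall>j k. next_avg S j k \<in> G"
proof (intro allI)
  fix j k
  note G = assms(3) and sx = assms(7) and sy = assms(8)
  \<comment> \<open>Maxima over the two interfaces of this cell stay real and strictly positive,
    which keeps \<theta> strictly between 0 and 1.\<close>
  define ax where "ax = max (\<sigma>x_plus S j k - \<sigma>x_minus S j k)
    (\<sigma>x_plus S (j - 1) k - \<sigma>x_minus S (j - 1) k)"
  define ay where "ay = max (\<sigma>y_plus S j k - \<sigma>y_minus S j k)
    (\<sigma>y_plus S j (k - 1) - \<sigma>y_minus S j (k - 1))"
  define a where "a = mesh_lambda S * ax"
  define b where "b = mesh_mu S * ay"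
  \<comment> \<open>This choice balances the directions: \<open>a / \<theta>\<close> and
    \<open>b / (1 - \<theta>)\<close> both equal \<open>a + b\<close>.\<close>
  define \<theta> where "\<theta> = a / (a + b)"
  have pos: "0 < mesh_lambda S" "0 < mesh_mu S"
    using assms(4-6) by (auto simp: mesh_lambda_def mesh_mu_def)
  have "0 < ax" "0 < ay"
    using sx[of j k] sy[of j k] by (auto simp: ax_def ay_def less_max_iff_disj)
  then have ab: "0 < a" "0 < b"
    using pos by (auto simp: a_def b_def)
  \<comment> \<open>Unfolding both maxima leaves four interface pairs, each an instance of the
    pointwise bound.\<close>
  have "a + b \<le> 1 / 2"
    using cfl_pointwise[OF less_imp_le[OF pos(1)] less_imp_le[OF pos(2)] assms(21)]
    unfolding a_def b_def ax_def ay_def max_def by auto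
  moreover have "1 - \<theta> = b / (a + b)"
    using ab by (simp add: \<theta>_def field_simps)
  ultimately have \<theta>: "0 < \<theta>" "\<theta> < 1" "a / \<theta> \<le> 1 / 2" "b / (1 - \<theta>) \<le> 1 / 2"
    using ab by (auto simp: \<theta>_def)
  have lx: "mesh_lambda S / \<theta> * s \<le> 1 / 2" if "s \<le> ax" for s
  proof -
    have "mesh_lambda S / \<theta> * s \<le> mesh_lambda S / \<theta> * ax"
      using that pos \<theta> by (intro mult_left_mono) auto
    also have "\<dots> = a / \<theta>"
      by (simp add: a_def)
    finally show ?thesis
      using \<theta>(3) by linarith
  qed
  have ly: "mesh_mu S / (1 - \<theta>) * s \<le> 1 / 2" if "s \<le> ay" for s
  proof -
    have "mesh_mu S / (1 - \<theta>) * s \<le> mesh_mu S / (1 - \<theta>) * ay"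
      using that pos \<theta> by (intro mult_left_mono) auto
    also have "\<dots> = b / (1 - \<theta>)"
      by (simp add: b_def)
    finally show ?thesis
      using \<theta>(4) by linarith
  qed
  define X where "X = avg S j k
    - (mesh_lambda S / \<theta>) *\<^sub>R (num_flux_x S j k - num_flux_x S (j - 1) k)"
  define Y where "Y = avg S j k
    - (mesh_mu S / (1 - \<theta>)) *\<^sub>R (num_flux_y S j k - num_flux_y S j (k - 1))"
  have "X \<in> G"
    unfolding X_def num_flux_x_def
  proof (rule cu_update_1d_in_convex[OF G])
    \<comment> \<open>Both traces belong to cell \<open>(j, k)\<close>, so their slope terms
      cancel.\<close>
    show "avg S j k = (1 / 2) *\<^sub>R (ux_minus S j k + ux_plus S (j - 1) k)"
      by (simp add: ux_minus_def ux_plus_def flip: scaleR_2)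
    show "mesh_lambda S / \<theta> * (\<sigma>x_plus S j k - \<sigma>x_minus S j k) \<le> 1 / 2"
      and "mesh_lambda S / \<theta> * (\<sigma>x_plus S (j - 1) k - \<sigma>x_minus S (j - 1) k) \<le> 1 / 2"
      by (auto intro!: lx simp only: ax_def max.cobounded1 max.cobounded2)
  qed (use pos \<theta> sx assms(9) assms(11,12) assms(15,16,19) in
      \<open>auto simp: ustar_x_def ustar_x_plus_def ustar_x_minus_def ustar_cell_x_def\<close>)
  moreover have "Y \<in> G"
    unfolding Y_def num_flux_y_def
  proof (rule cu_update_1d_in_convex[OF G])
    show "avg S j k = (1 / 2) *\<^sub>R (uy_minus S j k + uy_plus S j (k - 1))"
      by (simp add: uy_minus_def uy_plus_def flip: scaleR_2)
    show "mesh_mu S / (1 - \<theta>) * (\<sigma>y_plus S j k - \<sigma>y_minus S j k) \<le> 1 / 2"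
      and "mesh_mu S / (1 - \<theta>) * (\<sigma>y_plus S j (k - 1) - \<sigma>y_minus S j (k - 1)) \<le> 1 / 2"
      by (auto intro!: ly simp only: ay_def max.cobounded1 max.cobounded2)
  qed (use pos \<theta> sy assms(10) assms(13,14) assms(17,18,20) in
      \<open>auto simp: ustar_y_def ustar_y_plus_def ustar_y_minus_def ustar_cell_y_def\<close>)
  \<comment> \<open>The weights undo the enlargement of the mesh ratios in \<open>X\<close> and
    \<open>Y\<close>, and the two copies of the average add up to one.\<close>
  moreover have "next_avg S j k = \<theta> *\<^sub>R X + (1 - \<theta>) *\<^sub>R Y"
    using \<theta> by (simp add: next_avg_def X_def Y_def scaleR_diff_right)
      (simp add: algebra_simps)
  ultimately show "next_avg S j k \<in> G"
    using convexD[OF G, of X Y \<theta> "1 - \<theta>"] \<theta> by simp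
qed

end
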